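(* Let $\mu\in\mathbb{C}$, $t\in\mathbb{C}\setminus(-\infty,0]$, and let $r_N,\bar r_N$ ($N\ge 0$) be the reflection coefficients $r_N=(-1)^N I^{1}_N/I^0_N$, $\bar r_N=(-1)^N I^{-1}_N/I^0_N$ built from the Bessel Toeplitz determinants $I^{\epsilon}_N=\det[I_{\mu+\epsilon+j-k}(\sqrt t)]_{j,k=1,\dots,N}$, where it is assumed that $I^0_N\neq 0$ for all $N\ge 1$. Then for all $N\ge0$ $$\tfrac12\sqrt t\,\big(\bar r_{N+1}r_N-r_{N+1}\bar r_N\big)+\mu=0,$$ and for all $N\ge1$ the Adler–van Moerbeke recurrences $$\tfrac12\sqrt t\,(1-r_N\bar r_N)(r_{N+1}+r_{N-1})+N r_N=0,\qquad \tfrac12\sqrt t\,(1-r_N\bar r_N)(\bar r_{N+1}+\bar r_{N-1})+N\bar r_N=0$$ hold.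
   Context: $I_\alpha(x)$ denotes the modified Bessel function of the first kind of order $\alpha$, and $\sqrt t$ is the principal branch. For $\epsilon\in\{0,1,-1\}$ and $N\ge 0$ put $I^{\epsilon}_N:=\det[I_{\mu+\epsilon+j-k}(\sqrt t)]_{j,k=1,\dots,N}$, with $I^\epsilon_0:=1$ (so $r_0=\bar r_0=1$). The quantities $r_N$ and $\bar r_N$ are in general two independent quantities; the bar does not mean complex conjugation. *)

theory Defs
  imports
    "HOL-Analysis.Analysis"
    "Jordan_Normal_Form.Determinant"
begin

(* Principal branch: powr on complex numbers uses the principal logarithm. The reciprocal Gamma
   function rGamma is entire, with zeros at the poles of Gamma, so the definition makes sense
   for every order, including the negative integers. *)
definition bessel_I :: "complex \<Rightarrow> complex \<Rightarrow> complex" where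
  "bessel_I \<alpha> z =
     (z / 2) powr \<alpha> * (\<Sum>m. rGamma (\<alpha> + of_nat m + 1) * (z\<^sup>2 / 4) ^ m / fact m)"

(* The entries of a mat are indexed from 0, but they only depend on j - k, so this is the same
   matrix as with indices running from 1 to N. Both det and mat are also names of constants on
   vectors indexed by a finite type, whence the qualified names. *)
definition bessel_toeplitz_mat :: "complex \<Rightarrow> complex \<Rightarrow> int \<Rightarrow> nat \<Rightarrow> complex Matrix.mat" where
  "bessel_toeplitz_mat \<mu> t \<epsilon> N =
     Matrix.mat N N (\<lambda>(j, k). bessel_I (\<mu> + of_int \<epsilon> + of_nat j - of_nat k) (csqrt t))"

definition bessel_toeplitz :: "complex \<Rightarrow> complex \<Rightarrow> int \<Rightarrow> nat \<Rightarrow> complex" where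
  "bessel_toeplitz \<mu> t \<epsilon> N = Determinant.det (bessel_toeplitz_mat \<mu> t \<epsilon> N)"

lemma bessel_toeplitz_0 [simp]: "bessel_toeplitz \<mu> t \<epsilon> 0 = 1"
  by (simp add: bessel_toeplitz_def bessel_toeplitz_mat_def)

definition refl_coeff :: "complex \<Rightarrow> complex \<Rightarrow> nat \<Rightarrow> complex" where
  "refl_coeff \<mu> t N = (-1) ^ N * bessel_toeplitz \<mu> t 1 N / bessel_toeplitz \<mu> t 0 N"

(* The quantity written r with a bar; the bar is not complex conjugation. *)
definition refl_coeff_bar :: "complex \<Rightarrow> complex \<Rightarrow> nat \<Rightarrow> complex" where
  "refl_coeff_bar \<mu> t N = (-1) ^ N * bessel_toeplitz \<mu> t (-1) N / bessel_toeplitz \<mu> t 0 N"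

end

(*
Only the three-term recurrence \<open>(s/2) (w (n-1) - w (n+1)) = (\<mu> + n) w n\<close> of the moments
\<open>w n = I_{\<mu>+n}(s)\<close>, \<open>s = sqrt t\<close>, matters. The monic polynomials \<open>\<Phi>_N\<close> biorthogonal with respect
to the pairing \<open>(z^j, z^k) = w (j - k)\<close> satisfy \<open>\<Phi>_N 0 = r_N\<close>, and reversing the moments exchanges
\<open>r\<close> with \<open>rbar\<close> and \<open>\<mu>\<close> with \<open>-\<mu>\<close>. By the moment recurrence, \<open>z \<Phi>_N' - N \<Phi>_N\<close> is a
combination of \<open>\<Phi>_{N-1}\<close> and of the reversed polynomial \<open>\<Psi>*_{N-1}\<close>; evaluating it at 0 gives the
Adler-van Moerbeke recurrence. The recurrences for \<open>r\<close> and \<open>rbar\<close> together show that the left-hand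
side of the first identity does not depend on \<open>N\<close>, and for \<open>N = 0\<close> it is the moment recurrence.
*)
theory Submission
  imports Defs
begin

section \<open>Toeplitz determinants and biorthogonal polynomials\<close>

definition toeplitz_mat :: "(int \<Rightarrow> 'a::field) \<Rightarrow> nat \<Rightarrow> 'a Matrix.mat" where
  "toeplitz_mat w N = Matrix.mat N N (\<lambda>(j, k). w (int j - int k))"

definition toeplitz_det :: "(int \<Rightarrow> 'a::field) \<Rightarrow> nat \<Rightarrow> 'a" where
  "toeplitz_det w N = Determinant.det (toeplitz_mat w N)"

text \<open>The pairing of the polynomial with coefficients \<open>c j\<close>,
  \<open>j \<le> N\<close>, with \<open>z^k\<close>. The exponent is an integer because
  \<open>k = -1\<close> occurs.\<close>

definition moment_pairing :: "(int \<Rightarrow> 'a::field) \<Rightarrow> nat \<Rightarrow> (nat \<Rightarrow> 'a) \<Rightarrow> int \<Rightarrow> 'a" where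
  "moment_pairing w N c k = (\<Sum>j\<le>N. c j * w (int j - k))"

text \<open>The coefficients of \<open>\<Phi>_N\<close>; those of \<open>\<Psi>*_N\<close> are
  \<open>\<lambda>j. orth_coeff (\<lambda>n. w (- n)) N (N - j)\<close>.\<close>
definition orth_coeff :: "(int \<Rightarrow> 'a::field) \<Rightarrow> nat \<Rightarrow> nat \<Rightarrow> 'a" where
  "orth_coeff w N j = cofactor (toeplitz_mat w (Suc N)) j N / toeplitz_det w N"

text \<open>The pairing of \<Phi>_N with \<open>z^N\<close>; see
  \<open>moment_pairing_orth_coeff\<close>.\<close>

definition orth_norm :: "(int \<Rightarrow> 'a::field) \<Rightarrow> nat \<Rightarrow> 'a" where
  "orth_norm w N = toeplitz_det w (Suc N) / toeplitz_det w N"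

lemma toeplitz_mat_carrier [simp]: "toeplitz_mat w N \<in> carrier_mat N N"
  by (simp add: toeplitz_mat_def)

lemma toeplitz_det_reverse: "toeplitz_det (\<lambda>n. w (- n)) N = toeplitz_det w N"
proof -
  have "toeplitz_mat (\<lambda>n. w (- n)) N = transpose_mat (toeplitz_mat w N)"
    by (rule eq_matI) (auto simp: toeplitz_mat_def)
  then show ?thesis
    by (simp add: toeplitz_det_def det_transpose[OF toeplitz_mat_carrier])
qed

lemma orth_norm_reverse: "orth_norm (\<lambda>n. w (- n)) N = orth_norm w N"
  by (simp add: orth_norm_def toeplitz_det_reverse)

lemma orth_coeff_self:
  assumes "toeplitz_det w N \<noteq> 0"
  shows "orth_coeff w N N = 1"
proof -
  have "mat_delete (toeplitz_mat w (Suc N)) N N = toeplitz_mat w N"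
    by (rule eq_matI) (auto simp: toeplitz_mat_def mat_delete_def)
  then show ?thesis
    using assms by (simp add: orth_coeff_def cofactor_def toeplitz_det_def)
qed

text \<open>Deleting row 0 and column \<open>N\<close> raises every moment index by one; this is why
  \<Phi>_N(0) is the reflection coefficient.\<close>

lemma orth_coeff_0:
  "orth_coeff w N 0 = (-1) ^ N * toeplitz_det (\<lambda>n. w (n + 1)) N / toeplitz_det w N"
proof -
  have "mat_delete (toeplitz_mat w (Suc N)) 0 N = toeplitz_mat (\<lambda>n. w (n + 1)) N"
    by (rule eq_matI) (auto simp: toeplitz_mat_def mat_delete_def algebra_simps)
  then show ?thesis
    by (simp add: orth_coeff_def cofactor_def toeplitz_det_def)
qed

lemma orth_coeff_0_reverse:
  "orth_coeff (\<lambda>n. w (- n)) N 0 = (-1) ^ N * toeplitz_det (\<lambda>n. w (n - 1)) N / toeplitz_det w N"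
  using toeplitz_det_reverse[of "\<lambda>n. w (n - 1)" N]
  by (simp add: orth_coeff_0 toeplitz_det_reverse)

text \<open>Orthogonality is the last row of \<open>adj_mat ?M * ?M = det ?M * 1\<close>: a cofactor
  expansion along column \<open>N\<close> whose entries are replaced by those of column
  \<open>k\<close>.\<close>

lemma moment_pairing_orth_coeff:
  assumes "k \<le> N"
  shows "moment_pairing w N (orth_coeff w N) (int k) = (if k = N then orth_norm w N else 0)"
proof -
  let ?M = "toeplitz_mat w (Suc N)"
  have "(\<Sum>j\<le>N. cofactor ?M j N * w (int j - int k)) = (adj_mat ?M * ?M) $$ (N, k)"
    using assms
    by (simp add: adj_mat_def scalar_prod_def toeplitz_mat_def atLeast0LessThan lessThan_Suc_atMost)
  also have "\<dots> = (if k = N then toeplitz_det w (Suc N) else 0)"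
    using assms adj_mat(3)[OF toeplitz_mat_carrier[of w "Suc N"]] by (simp add: toeplitz_det_def)
  finally show ?thesis
    by (simp add: moment_pairing_def orth_coeff_def orth_norm_def flip: sum_divide_distrib)
qed

lemma moment_pairing_reverse:
  "moment_pairing w N (\<lambda>j. c (N - j)) k = moment_pairing (\<lambda>n. w (- n)) N c (int N - k)"
  unfolding moment_pairing_def atMost_atLeast0
  by (subst sum.atLeastAtMost_rev) (auto intro!: sum.cong simp: algebra_simps of_nat_diff)

lemma moment_pairing_reverse_orth_coeff:
  assumes "k \<le> N"
  shows "moment_pairing w N (\<lambda>j. orth_coeff (\<lambda>n. w (- n)) N (N - j)) (int k) =
    (if k = 0 then orth_norm w N else 0)"
  using moment_pairing_orth_coeff[of "N - k" N "\<lambda>n. w (- n)"] assms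
  by (auto simp: moment_pairing_reverse orth_norm_reverse of_nat_diff)

text \<open>Nondegeneracy of the pairing: the coefficients of the difference form a vector in the
  kernel of the transposed Toeplitz matrix. Polynomial identities below are proved by comparing
  pairings.\<close>

lemma eq_if_moment_pairing_eq:
  assumes det: "toeplitz_det w (Suc N) \<noteq> 0"
    and eq: "\<And>k. k \<le> N \<Longrightarrow> moment_pairing w N u (int k) = moment_pairing w N v (int k)"
    and "i \<le> N"
  shows "u i = v i"
proof -
  let ?x = "Matrix.vec (Suc N) (\<lambda>j. u j - v j)"
  let ?A = "transpose_mat (toeplitz_mat w (Suc N))"
  have A: "?A \<in> carrier_mat (Suc N) (Suc N)"
    by simp
  have "?A *\<^sub>v ?x = 0\<^sub>v (Suc N)"
  proof (rule eq_vecI)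
    fix k assume "k < dim_vec (0\<^sub>v (Suc N) :: 'a vec)"
    then have k: "k \<le> N" by simp
    then have "(?A *\<^sub>v ?x) $ k = (\<Sum>j\<le>N. w (int j - int k) * (u j - v j))"
      by (simp add: scalar_prod_def toeplitz_mat_def atLeast0LessThan lessThan_Suc_atMost)
    also have "\<dots> = moment_pairing w N u (int k) - moment_pairing w N v (int k)"
      by (simp add: moment_pairing_def sum_subtractf algebra_simps)
    finally show "(?A *\<^sub>v ?x) $ k = 0\<^sub>v (Suc N) $ k"
      using eq[OF k] k by simp
  qed (simp add: toeplitz_mat_def)
  moreover have "Determinant.det ?A \<noteq> 0"
    using det by (simp add: toeplitz_det_def det_transpose[OF toeplitz_mat_carrier])
  ultimately have "?x = 0\<^sub>v (Suc N)"
    using det_0_iff_vec_prod_zero[OF A] by (metis vec_carrier)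
  then have "?x $ i = 0\<^sub>v (Suc N) $ i"
    by simp
  with \<open>i \<le> N\<close> show ?thesis
    by simp
qed

section \<open>Recurrences for the biorthogonal polynomials\<close>

lemma moment_pairing_add:
  "moment_pairing w N (\<lambda>j. a * u j + b * v j) k = a * moment_pairing w N u k + b * moment_pairing w N v k"
  by (simp add: moment_pairing_def sum.distrib sum_distrib_left algebra_simps)

text \<open>The first claim is \<open>\<Phi>_{N+1} = z \<Phi>_N + r_{N+1} \<Psi>*_N\<close>; pairing it with \<open>z^0\<close> gives the second.\<close>
lemma szego_recurrence:
  assumes nz: "\<And>N. toeplitz_det w N \<noteq> 0"
  shows "i \<le> Suc N \<Longrightarrow> orth_coeff w (Suc N) i = (if i = 0 then 0 else orth_coeff w N (i - 1))
     + orth_coeff w (Suc N) 0 * (if i = Suc N then 0 else orth_coeff (\<lambda>n. w (- n)) N (N - i))"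
    and "moment_pairing w N (orth_coeff w N) (-1) = - orth_coeff w (Suc N) 0 * orth_norm w N"
proof -
  define p where "p = moment_pairing w N (orth_coeff w N) (-1)"
  \<comment> \<open>Chosen so that \<Phi>_{N+1} - z \<Phi>_N and \<open>- x\<close> times
    \<open>\<psi>\<close> have the same pairing with \<open>z^0\<close>.\<close>
  define x where "x = p / orth_norm w N"
  define \<psi> where "\<psi> = (\<lambda>j. orth_coeff (\<lambda>n. w (- n)) N (N - j))"
  have h: "orth_norm w N \<noteq> 0"
    by (simp add: orth_norm_def nz)
  have top: "orth_coeff w (Suc N) (Suc N) = 1" "orth_coeff w N N = 1" "\<psi> 0 = 1"
    by (simp_all add: \<psi>_def orth_coeff_self nz toeplitz_det_reverse)
  \<comment> \<open>Multiplying a polynomial by \<open>z\<close> lowers the exponent it is paired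
    with by one.\<close>
  have shift: "(\<Sum>j\<le>Suc N. (if j = 0 then 0 else orth_coeff w N (j - 1)) * w (int j - k))
      = moment_pairing w N (orth_coeff w N) (k - 1)" for k
    by (simp add: sum.atMost_Suc_shift moment_pairing_def algebra_simps del: sum.atMost_Suc)
  have rec: "orth_coeff w (Suc N) i = (if i = 0 then 0 else orth_coeff w N (i - 1)) + (- x) * \<psi> i"
    if "i \<le> N" for i
  proof -
    \<comment> \<open>\<Phi>_{N+1} - z \<Phi>_N: both terms are monic, so the degree is at most
      \<open>N\<close> and nondegeneracy applies.\<close>
    let ?u = "\<lambda>j. 1 * orth_coeff w (Suc N) j + (-1) * (if j = 0 then 0 else orth_coeff w N (j - 1))"
    have "moment_pairing w N ?u (int k) = moment_pairing w N (\<lambda>j. (- x) * \<psi> j) (int k)"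
      if "k \<le> N" for k
    proof -
      have "moment_pairing w N ?u (int k) = (\<Sum>j\<le>Suc N. ?u j * w (int j - int k))"
        by (simp add: moment_pairing_def top)
      also have "\<dots> = moment_pairing w (Suc N) (orth_coeff w (Suc N)) (int k)
          - moment_pairing w N (orth_coeff w N) (int k - 1)"
        unfolding shift[symmetric]
        by (simp add: moment_pairing_def sum_subtractf left_diff_distrib del: sum.atMost_Suc)
      also have "moment_pairing w (Suc N) (orth_coeff w (Suc N)) (int k) = 0"
        using that by (subst moment_pairing_orth_coeff) auto
      also have "moment_pairing w N (orth_coeff w N) (int k - 1) = (if k = 0 then p else 0)"
      proof (cases k)
        case 0
        then show ?thesis by (simp add: p_def)
      next
        case (Suc l)
        then show ?thesis
          using moment_pairing_orth_coeff[of l N w] that by simp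
      qed
      also have "0 - (if k = 0 then p else 0) = (- x) * moment_pairing w N \<psi> (int k)"
        unfolding \<psi>_def using that h by (subst moment_pairing_reverse_orth_coeff) (auto simp: x_def)
      also have "\<dots> = moment_pairing w N (\<lambda>j. (- x) * \<psi> j) (int k)"
        by (simp add: moment_pairing_def sum_distrib_left algebra_simps flip: sum_negf)
      finally show ?thesis .
    qed
    from eq_if_moment_pairing_eq[OF nz this \<open>i \<le> N\<close>] show ?thesis
      by (simp add: algebra_simps)
  qed
  \<comment> \<open>Evaluation at 0 identifies \<open>- x\<close>, since \<open>z \<Phi>_N\<close>
    vanishes there and \<open>\<psi> 0 = 1\<close>.\<close>
  from rec[of 0] have r: "orth_coeff w (Suc N) 0 = - x"
    by (simp add: top)
  then show "moment_pairing w N (orth_coeff w N) (-1) = - orth_coeff w (Suc N) 0 * orth_norm w N"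
    using h by (simp add: x_def p_def)
  show "orth_coeff w (Suc N) i = (if i = 0 then 0 else orth_coeff w N (i - 1))
     + orth_coeff w (Suc N) 0 * (if i = Suc N then 0 else orth_coeff (\<lambda>n. w (- n)) N (N - i))"
    if "i \<le> Suc N"
    using rec[of i] \<open>i \<le> Suc N\<close> r top by (cases "i = Suc N") (auto simp: \<psi>_def)
qed

text \<open>Pair the Szego recurrence with \<open>z^(N+1)\<close>: the shifted term gives the
  previous norm, and the reversed polynomial becomes, for the reversed moments, a pairing with
  \<open>z^(-1)\<close>.\<close>

lemma orth_norm_Suc:
  assumes nz: "\<And>N. toeplitz_det w N \<noteq> 0"
  shows "orth_norm w (Suc N) =
    (1 - orth_coeff w (Suc N) 0 * orth_coeff (\<lambda>n. w (- n)) (Suc N) 0) * orth_norm w N"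
proof -
  let ?c = "orth_coeff w (Suc N) 0" and ?w' = "\<lambda>n. w (- n)"
  have "orth_norm w (Suc N) = moment_pairing w (Suc N) (orth_coeff w (Suc N)) (int (Suc N))"
    by (subst moment_pairing_orth_coeff) auto
  also have "\<dots> = (\<Sum>i\<le>Suc N. ((if i = 0 then 0 else orth_coeff w N (i - 1))
     + ?c * (if i = Suc N then 0 else orth_coeff ?w' N (N - i))) * w (int i - int (Suc N)))"
    unfolding moment_pairing_def
  proof (intro sum.cong refl)
    fix i assume "i \<in> {..Suc N}"
    then show "orth_coeff w (Suc N) i * w (int i - int (Suc N)) =
      ((if i = 0 then 0 else orth_coeff w N (i - 1))
        + ?c * (if i = Suc N then 0 else orth_coeff ?w' N (N - i))) * w (int i - int (Suc N))"
      using szego_recurrence(1)[OF nz, of i N] by simp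
  qed
  also have "\<dots> = (\<Sum>i\<le>Suc N. (if i = 0 then 0 else orth_coeff w N (i - 1)) * w (int i - int (Suc N)))
     + ?c * (\<Sum>i\<le>Suc N. (if i = Suc N then 0 else orth_coeff ?w' N (N - i)) * w (int i - int (Suc N)))"
    by (simp add: distrib_right sum.distrib sum_distrib_left mult.assoc del: sum.atMost_Suc)
  also have "(\<Sum>i\<le>Suc N. (if i = 0 then 0 else orth_coeff w N (i - 1)) * w (int i - int (Suc N)))
      = moment_pairing w N (orth_coeff w N) (int N)"
    by (simp add: sum.atMost_Suc_shift moment_pairing_def del: sum.atMost_Suc)
  also have "\<dots> = orth_norm w N"
    by (subst moment_pairing_orth_coeff) auto
  also have "(\<Sum>i\<le>Suc N. (if i = Suc N then 0 else orth_coeff ?w' N (N - i)) * w (int i - int (Suc N)))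
      = moment_pairing w N (\<lambda>j. orth_coeff ?w' N (N - j)) (int (Suc N))"
    by (simp add: moment_pairing_def)
  also have "\<dots> = moment_pairing ?w' N (orth_coeff ?w' N) (-1)"
    by (simp add: moment_pairing_reverse)
  also have "\<dots> = - orth_coeff ?w' (Suc N) 0 * orth_norm w N"
    by (subst szego_recurrence(2)) (simp_all add: nz toeplitz_det_reverse orth_norm_reverse)
  finally show ?thesis
    by (simp add: algebra_simps)
qed

text \<open>Constant term of z \<Phi>_{N+1}' - (N+1) \<Phi>_{N+1} = \<sigma> \<rho> (\<Phi>_N +
  r_{N+2} \<Psi>*_N), where \<rho> = 1 - r_{N+1} rbar_{N+1}. Both sides have degree at most
  \<open>N\<close>.\<close>

lemma adler_van_moerbeke:
  fixes w :: "int \<Rightarrow> 'a::field"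
  assumes nz: "\<And>N. toeplitz_det w N \<noteq> 0"
    and rec: "\<And>n. \<sigma> * (w (n - 1) - w (n + 1)) = (\<mu> + of_int n) * w n"
  shows "\<sigma> * (1 - orth_coeff w (Suc N) 0 * orth_coeff (\<lambda>n. w (- n)) (Suc N) 0)
      * (orth_coeff w (Suc (Suc N)) 0 + orth_coeff w N 0) + of_nat (Suc N) * orth_coeff w (Suc N) 0 = 0"
proof -
  let ?N = "Suc N"
  let ?c = "orth_coeff w ?N" and ?w' = "\<lambda>n. w (- n)"
  define \<rho> where "\<rho> = 1 - ?c 0 * orth_coeff ?w' ?N 0"
  define \<psi> where "\<psi> = (\<lambda>j. orth_coeff ?w' N (N - j))"
  let ?u = "\<lambda>j. (of_nat j - of_nat ?N) * ?c j"
  let ?v = "\<lambda>j. (\<sigma> * \<rho>) * orth_coeff w N j + (\<sigma> * \<rho> * orth_coeff w (Suc ?N) 0) * \<psi> j"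
  have h: "orth_norm w ?N = \<rho> * orth_norm w N"
    by (simp add: \<rho>_def orth_norm_Suc[OF nz])
  have "moment_pairing w N ?u (int k) = moment_pairing w N ?v (int k)" if k: "k \<le> N" for k
  proof -
    \<comment> \<open>The added top term has the factor \<open>?N - ?N = 0\<close>.\<close>
    have "moment_pairing w N ?u (int k) = moment_pairing w ?N ?u (int k)"
      by (simp add: moment_pairing_def)
    also have "\<dots> = (\<Sum>j\<le>?N. (of_int (int k) - \<mu> - of_nat ?N) * (?c j * w (int j - int k))
        + \<sigma> * (?c j * w (int j - (int k + 1)) - ?c j * w (int j - (int k - 1))))"
      unfolding moment_pairing_def
    proof (intro sum.cong refl)
      fix j
      \<comment> \<open>Write \<open>j\<close> as \<open>(\<mu> + j - k) + (k - \<mu>)\<close>; the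
        moment recurrence trades the first summand for shifts of the moment index.\<close>
      have "of_nat j * w (int j - int k) = (of_nat k - \<mu>) * w (int j - int k)
        + \<sigma> * (w (int j - (int k + 1)) - w (int j - (int k - 1)))"
        using rec[of "int j - int k"] by (simp add: algebra_simps)
      then have "?c j * (of_nat j * w (int j - int k)) = ?c j * ((of_nat k - \<mu>) * w (int j - int k)
        + \<sigma> * (w (int j - (int k + 1)) - w (int j - (int k - 1))))"
        by simp
      then show "?u j * w (int j - int k) = (of_int (int k) - \<mu> - of_nat ?N) * (?c j * w (int j - int k))
        + \<sigma> * (?c j * w (int j - (int k + 1)) - ?c j * w (int j - (int k - 1)))"
        by (simp add: algebra_simps)
    qed
    also have "\<dots> = (of_int (int k) - \<mu> - of_nat ?N) * moment_pairing w ?N ?c (int k)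
        + \<sigma> * (moment_pairing w ?N ?c (int k + 1) - moment_pairing w ?N ?c (int k - 1))"
      unfolding moment_pairing_def sum.distrib sum_subtractf sum_distrib_left right_diff_distrib ..
    also have "moment_pairing w ?N ?c (int k) = 0"
      using k by (subst moment_pairing_orth_coeff) auto
    \<comment> \<open>Orthogonality leaves only the boundary cases: \<open>k = N\<close> here, where
      the exponent is the degree, and below \<open>k = 0\<close>, where it is -1.\<close>
    also have "moment_pairing w ?N ?c (int k + 1) = (if k = N then \<rho> * orth_norm w N else 0)"
      using k moment_pairing_orth_coeff[of "Suc k" ?N w] h by (simp add: add.commute)
    also have "moment_pairing w ?N ?c (int k - 1) =
        (if k = 0 then - orth_coeff w (Suc ?N) 0 * (\<rho> * orth_norm w N) else 0)"
    proof (cases k)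
      case 0
      then show ?thesis
        using szego_recurrence(2)[OF nz, of ?N] h by simp
    next
      case (Suc l)
      then show ?thesis
        using moment_pairing_orth_coeff[of l ?N w] k by simp
    qed
    also have "(of_int (int k) - \<mu> - of_nat ?N) * 0 + \<sigma> * ((if k = N then \<rho> * orth_norm w N else 0)
        - (if k = 0 then - orth_coeff w (Suc ?N) 0 * (\<rho> * orth_norm w N) else 0))
       = moment_pairing w N ?v (int k)"
      unfolding moment_pairing_add \<psi>_def moment_pairing_orth_coeff[OF k]
        moment_pairing_reverse_orth_coeff[OF k]
      by (simp add: algebra_simps)
    finally show ?thesis .
  qed
  from eq_if_moment_pairing_eq[OF nz this, of 0]
  have "?u 0 = ?v 0"
    by simp
  moreover have "\<psi> 0 = 1"
    by (simp add: \<psi>_def orth_coeff_self nz toeplitz_det_reverse)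
  ultimately show ?thesis
    unfolding \<rho>_def by (simp add: algebra_simps)
qed

section \<open>The Bessel series and its three-term recurrence\<close>

lemma summable_bessel_I_terms:
  "summable (\<lambda>m. rGamma (\<alpha> + of_nat m + 1) * q ^ m / fact m :: complex)"
proof -
  \<comment> \<open>From \<open>M\<close> on, \<open>\<alpha> + m + 1\<close> has norm at least
    \<open>2 * norm q + 1\<close>, so it is nonzero and the ratio of successive terms is at most
    1/2.\<close>
  obtain M :: nat where M: "real M \<ge> 2 * norm q + norm \<alpha> + 1"
    using real_arch_simple by blast
  show ?thesis
  proof (rule summable_ratio_test[of "1 / 2" M])
    fix m assume "m \<ge> M"
    define \<beta> where "\<beta> = \<alpha> + of_nat m + 1"
    have "real m \<ge> 2 * norm q + norm \<alpha> + 1"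
      using M \<open>m \<ge> M\<close> by linarith
    moreover have "real m - norm \<alpha> \<le> norm \<beta>"
    proof -
      have "real (Suc m) = norm (\<beta> - \<alpha>)"
        unfolding \<beta>_def using norm_of_nat[of "Suc m", where 'a = complex]
        by (simp add: algebra_simps del: norm_of_nat)
      also have "\<dots> \<le> norm \<beta> + norm \<alpha>"
        by (rule norm_triangle_ineq4)
      finally show ?thesis by simp
    qed
    ultimately have \<beta>: "norm \<beta> \<ge> 2 * norm q + 1"
      by linarith
    then have \<beta>0: "\<beta> \<noteq> 0"
      using norm_ge_zero[of q] by (auto simp del: norm_ge_zero)
    have rG: "rGamma (\<alpha> + of_nat (Suc m) + 1) = rGamma \<beta> / \<beta>"
      using rGamma_plus1[of \<beta>] \<beta>0 by (simp add: \<beta>_def field_simps)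
    have eq: "norm (rGamma (\<alpha> + of_nat (Suc m) + 1) * q ^ Suc m / fact (Suc m))
      = norm (rGamma \<beta> * q ^ m / fact m) * (norm q / (norm \<beta> * real (Suc m)))"
      unfolding rG by (simp add: norm_mult norm_divide norm_power field_simps
          del: of_nat_Suc)
    have "norm q / (norm \<beta> * real (Suc m)) \<le> 1 / 2"
    proof -
      have "2 * norm q \<le> norm \<beta> * 1"
        using \<beta> by simp
      also have "\<dots> \<le> norm \<beta> * real (Suc m)"
        by (intro mult_left_mono) auto
      finally show ?thesis
        using \<beta>0 by (simp add: divide_simps del: of_nat_Suc)
    qed
    then have "norm (rGamma \<beta> * q ^ m / fact m) * (norm q / (norm \<beta> * real (Suc m)))
        \<le> norm (rGamma \<beta> * q ^ m / fact m) * (1 / 2)"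
      by (rule mult_left_mono) simp
    then show "norm (rGamma (\<alpha> + of_nat (Suc m) + 1) * q ^ Suc m / fact (Suc m))
       \<le> 1 / 2 * norm (rGamma (\<alpha> + of_nat m + 1) * q ^ m / fact m)"
      unfolding eq \<beta>_def by (simp only: mult.commute)
  qed simp
qed

text \<open>Compare coefficients, using that rGamma(\<alpha> + m) = (\<alpha> + m) rGamma(\<alpha> +
  m + 1) holds without exceptions. The part with factor \<open>m\<close> is the series of order
  \<open>\<alpha> + 1\<close> with its index shifted.\<close>

lemma bessel_I_recurrence:
  assumes "z \<noteq> 0"
  shows "z / 2 * (bessel_I (\<alpha> - 1) z - bessel_I (\<alpha> + 1) z) = \<alpha> * bessel_I \<alpha> z"
proof -
  define q where "q = z\<^sup>2 / 4"
  define F where "F = (\<lambda>\<beta>. \<Sum>m. rGamma (\<beta> + of_nat m + 1) * q ^ m / fact m :: complex)"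
  have sums: "(\<lambda>m. rGamma (\<beta> + of_nat m + 1) * q ^ m / fact m) sums F \<beta>" for \<beta>
    unfolding F_def by (rule summable_sums summable_bessel_I_terms)+
  have "(\<lambda>m. q * (rGamma (\<alpha> + 1 + of_nat m + 1) * q ^ m / fact m)) sums (q * F (\<alpha> + 1))"
    by (intro sums_mult sums)
  also have "(\<lambda>m. q * (rGamma (\<alpha> + 1 + of_nat m + 1) * q ^ m / fact m)) =
     (\<lambda>m. of_nat (Suc m) * (rGamma (\<alpha> + of_nat (Suc m) + 1) * q ^ Suc m / fact (Suc m)))"
    by (simp add: fun_eq_iff add_ac del: of_nat_Suc) (simp add: add_ac)
  \<comment> \<open>The index shift adds only the term at \<open>m = 0\<close>, which is
    zero.\<close>
  finally have "(\<lambda>m. of_nat m * (rGamma (\<alpha> + of_nat m + 1) * q ^ m / fact m)) sums (q * F (\<alpha> + 1))"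
    by (subst (asm) sums_Suc_iff) simp
  from sums_add[OF this sums_mult[OF sums[of \<alpha>], of \<alpha>]]
  have "(\<lambda>m. rGamma (\<alpha> - 1 + of_nat m + 1) * q ^ m / fact m) sums (q * F (\<alpha> + 1) + \<alpha> * F \<alpha>)"
  proof (rule ssubst[of _ _ "\<lambda>f. f sums _", rotated], intro ext)
    fix m
    show "rGamma (\<alpha> - 1 + of_nat m + 1) * q ^ m / fact m
      = of_nat m * (rGamma (\<alpha> + of_nat m + 1) * q ^ m / fact m)
        + \<alpha> * (rGamma (\<alpha> + of_nat m + 1) * q ^ m / fact m)"
      using rGamma_plus1[of "\<alpha> + of_nat m", symmetric]
      by (simp add: distrib_right add_divide_distrib mult.assoc)
  qed
  with sums[of "\<alpha> - 1"] have F: "F (\<alpha> - 1) = q * F (\<alpha> + 1) + \<alpha> * F \<alpha>"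
    by (rule sums_unique2)
  have I: "bessel_I \<beta> z = (z / 2) powr \<beta> * F \<beta>" for \<beta>
    by (simp add: bessel_I_def F_def q_def)
  have powr: "(z / 2) powr (\<alpha> + 1) = (z / 2) powr \<alpha> * (z / 2)"
    and powr': "(z / 2) powr (\<alpha> - 1) = (z / 2) powr \<alpha> / (z / 2)"
    using assms by (simp_all add: powr_add powr_diff)
  then show ?thesis
    unfolding I F powr powr' using assms by (simp add: q_def field_simps power2_eq_square)
qed

section \<open>Reflection coefficients of the Bessel moments\<close>

lemma bessel_toeplitz_eq:
  "bessel_toeplitz \<mu> t \<epsilon> N = toeplitz_det (\<lambda>n. bessel_I (\<mu> + of_int (n + \<epsilon>)) (csqrt t)) N"
  unfolding bessel_toeplitz_def bessel_toeplitz_mat_def toeplitz_det_def toeplitz_mat_def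
  by (simp add: algebra_simps)

theorem mainTheorem6:
  fixes \<mu> t :: complex and r rbar :: "nat \<Rightarrow> complex"
  defines "r \<equiv> refl_coeff \<mu> t"
    and "rbar \<equiv> refl_coeff_bar \<mu> t"
  assumes t: "t \<notin> \<real>\<^sub>\<le>\<^sub>0"
    and nonzero: "\<And>N. N \<ge> 1 \<Longrightarrow> bessel_toeplitz \<mu> t 0 N \<noteq> 0"
  shows "(\<forall>N. 1 / 2 * csqrt t * (rbar (N + 1) * r N - r (N + 1) * rbar N) + \<mu> = 0) \<and>
    (\<forall>N\<ge>1. 1 / 2 * csqrt t * (1 - r N * rbar N) * (r (N + 1) + r (N - 1)) + of_nat N * r N = 0 \<and>
           1 / 2 * csqrt t * (1 - r N * rbar N) * (rbar (N + 1) + rbar (N - 1)) + of_nat N * rbar N = 0)"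
proof -
  define w where "w = (\<lambda>n. bessel_I (\<mu> + of_int n) (csqrt t))"
  define \<sigma> where "\<sigma> = 1 / 2 * csqrt t"
  let ?w' = "\<lambda>n. w (- n)"
  have nz: "toeplitz_det w N \<noteq> 0" for N
    using nonzero[of N] bessel_toeplitz_0[of \<mu> t 0]
    by (cases N) (simp_all add: bessel_toeplitz_eq w_def)
  then have nz': "toeplitz_det ?w' N \<noteq> 0" for N
    by (simp add: toeplitz_det_reverse)
  have r: "r N = orth_coeff w N 0" for N
    by (simp add: r_def refl_coeff_def orth_coeff_0 bessel_toeplitz_eq w_def)
  have rbar: "rbar N = orth_coeff ?w' N 0" for N
    by (simp add: rbar_def refl_coeff_bar_def orth_coeff_0_reverse bessel_toeplitz_eq)
      (simp add: w_def)
  have "csqrt t \<noteq> 0"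
    using t by auto
  then have rec: "\<sigma> * (w (n - 1) - w (n + 1)) = (\<mu> + of_int n) * w n" for n
    using bessel_I_recurrence[of "csqrt t" "\<mu> + of_int n"]
    by (simp add: w_def \<sigma>_def algebra_simps)
  have rec': "\<sigma> * (?w' (n - 1) - ?w' (n + 1)) = (- \<mu> + of_int n) * ?w' n" for n
  proof -
    have n: "- (n - 1) = - n + 1" "- (n + 1) = - n - 1"
      by simp_all
    show ?thesis
      unfolding n using rec[of "- n"] by (simp only: of_int_minus) (simp add: algebra_simps)
  qed
  have avm: "\<sigma> * (1 - r (Suc N) * rbar (Suc N)) * (r (Suc (Suc N)) + r N)
      + of_nat (Suc N) * r (Suc N) = 0" for N
    using adler_van_moerbeke[OF nz rec] by (simp add: r rbar)
  have avm': "\<sigma> * (1 - r (Suc N) * rbar (Suc N)) * (rbar (Suc (Suc N)) + rbar N)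
      + of_nat (Suc N) * rbar (Suc N) = 0" for N
    using adler_van_moerbeke[OF nz' rec', of N] by (simp add: r rbar mult.commute)
  have "\<sigma> * (rbar (N + 1) * r N - r (N + 1) * rbar N) + \<mu> = 0" for N
  proof (induction N)
    case 0
    have "w 0 \<noteq> 0"
      using nz[of 1] by (simp add: toeplitz_det_def toeplitz_mat_def det_single)
    then have \<mu>: "\<mu> = \<sigma> * (w (-1) - w 1) / w 0"
      using rec[of 0] by simp
    have "r 0 = 1" "rbar 0 = 1" "r (0 + 1) = - w 1 / w 0" "rbar (0 + 1) = - w (-1) / w 0"
      by (simp_all add: r rbar orth_coeff_0 toeplitz_det_def toeplitz_mat_def det_single)
    then show ?case
      unfolding \<mu> by (simp add: right_diff_distrib diff_divide_distrib)
  next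
    case (Suc N)
    let ?\<rho> = "1 - r (Suc N) * rbar (Suc N)"
    \<comment> \<open>\<open>?\<rho>\<close> is the ratio of two successive norms, which are
      nonzero.\<close>
    have "?\<rho> \<noteq> 0"
      using orth_norm_Suc[OF nz, of N] by (auto simp: r rbar orth_norm_def nz)
    \<comment> \<open>The increment of the left-hand side, times \<open>?\<rho>\<close>, combines
      the two recurrences; after substitution the terms \<open>(N+1) r rbar\<close> cancel.\<close>
    have "?\<rho> * (\<sigma> * (rbar (Suc N + 1) * r (Suc N) - r (Suc N + 1) * rbar (Suc N))
        - \<sigma> * (rbar (N + 1) * r N - r (N + 1) * rbar N))
      = r (Suc N) * (\<sigma> * ?\<rho> * (rbar (Suc (Suc N)) + rbar N))
        - rbar (Suc N) * (\<sigma> * ?\<rho> * (r (Suc (Suc N)) + r N))"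
      by (simp add: algebra_simps)
    also have "\<dots> = r (Suc N) * (- of_nat (Suc N) * rbar (Suc N))
        - rbar (Suc N) * (- of_nat (Suc N) * r (Suc N))"
      using avm[of N] avm'[of N] by (simp only: add_eq_0_iff2 minus_mult_left)
    also have "\<dots> = 0"
      by simp
    finally have "\<sigma> * (rbar (Suc N + 1) * r (Suc N) - r (Suc N + 1) * rbar (Suc N))
        = \<sigma> * (rbar (N + 1) * r N - r (N + 1) * rbar N)"
      using \<open>?\<rho> \<noteq> 0\<close> by simp
    with Suc.IH show ?case
      by (simp only:)
  qed
  moreover have "\<sigma> * (1 - r N * rbar N) * (r (N + 1) + r (N - 1)) + of_nat N * r N = 0 \<and>
      \<sigma> * (1 - r N * rbar N) * (rbar (N + 1) + rbar (N - 1)) + of_nat N * rbar N = 0" if "N \<ge> 1" for N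
    using that avm[of "N - 1"] avm'[of "N - 1"] by simp
  ultimately show ?thesis
    unfolding \<sigma>_def by blast
qed

end
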